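(* Let $\Lambda$ be a set, $\mathbb{F}$ a field, and let $K,Q:\Lambda^2\to\mathbb{F}$ be two (not necessarily symmetric) functions such that $K(x,y)\neq 0$ and $Q(x,y)\neq 0$ for all $x,y\in\Lambda$ with $x\neq y$ (the values on the diagonal $\{(x,x):x\in\Lambda\}$ are allowed to be zero). Suppose further that for every pairwise distinct $x,y,z,w\in\Lambda$, $$\begin{vmatrix} Q(x,y) & Q(x,w)\\ Q(z,y) & Q(z,w)\end{vmatrix}\neq 0.$$ If $K$ and $Q$ are determinantally equivalent, then $Q$ can be transformed into $K$ through only conjugation and transposition transformations, i.e. $K$ is obtained from $Q$ by applying a finite sequence of transformations, each of which is a conjugation transformation or the transposition transformation.
   Context: Let $\Lambda$ be a set (of arbitrary cardinality) and $\mathbb{F}$ an arbitrary field. Two functions $K,Q:\Lambda^2\to\mathbb{F}$ are determinantally equivalent if $$\det(Q(x_i,x_j))_{i,j=1}^n=\det(K(x_i,x_j))_{i,j=1}^n\qquad\text{for all } n\in\mathbb{N}=\{1,2,\ldots\}\text{ and all } x_1,\ldots,x_n\in\Lambda.$$ A conjugation transformation sends a function $f:\Lambda^2\to\mathbb{F}$ to the function $(x,y)\mapsto g(x)g(y)^{-1}f(x,y)$ for some nowhere-zero function $g:\Lambda\to\mathbb{F}$. The transposition transformation sends $f:\Lambda^2\to\mathbb{F}$ to the function $(x,y)\mapsto f(y,x)$. *)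

theory Defs
  imports "Jordan_Normal_Form.Determinant"
begin

text \<open>
  A function on the square of the set \<open>\<Lambda>\<close> is represented by a curried total function on the
  ambient type, of which only the values on \<open>\<Lambda>\<close> are relevant. Matrix indices start from \<open>0\<close>.
\<close>

definition determinantally_equivalent ::
    "'a set \<Rightarrow> ('a \<Rightarrow> 'a \<Rightarrow> 'f::field) \<Rightarrow> ('a \<Rightarrow> 'a \<Rightarrow> 'f) \<Rightarrow> bool" where
  "determinantally_equivalent \<Lambda> K Q \<longleftrightarrow>
     (\<forall>n\<ge>1. \<forall>x :: nat \<Rightarrow> 'a. (\<forall>i<n. x i \<in> \<Lambda>) \<longrightarrow>
        det (mat n n (\<lambda>(i, j). Q (x i) (x j))) = det (mat n n (\<lambda>(i, j). K (x i) (x j))))"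

definition conjugation :: "('a \<Rightarrow> 'f::field) \<Rightarrow> ('a \<Rightarrow> 'a \<Rightarrow> 'f) \<Rightarrow> 'a \<Rightarrow> 'a \<Rightarrow> 'f" where
  "conjugation g f = (\<lambda>x y. g x * inverse (g y) * f x y)"

definition transposition :: "('a \<Rightarrow> 'a \<Rightarrow> 'f) \<Rightarrow> 'a \<Rightarrow> 'a \<Rightarrow> 'f" where
  "transposition f = (\<lambda>x y. f y x)"

definition transformation_step ::
    "'a set \<Rightarrow> ('a \<Rightarrow> 'a \<Rightarrow> 'f::field) \<Rightarrow> ('a \<Rightarrow> 'a \<Rightarrow> 'f) \<Rightarrow> bool" where
  "transformation_step \<Lambda> f f' \<longleftrightarrow>
     (\<exists>g. (\<forall>x\<in>\<Lambda>. g x \<noteq> 0) \<and> f' = conjugation g f) \<or> f' = transposition f"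

text \<open>
  The steps act on total functions, so the last function \<open>f'\<close> of the finite sequence is compared
  with \<open>K\<close> on \<open>\<Lambda>\<close> only.
\<close>

definition transformable_into ::
    "'a set \<Rightarrow> ('a \<Rightarrow> 'a \<Rightarrow> 'f::field) \<Rightarrow> ('a \<Rightarrow> 'a \<Rightarrow> 'f) \<Rightarrow> bool" where
  "transformable_into \<Lambda> Q K \<longleftrightarrow>
     (\<exists>f'. (transformation_step \<Lambda>)\<^sup>*\<^sup>* Q f' \<and> (\<forall>x\<in>\<Lambda>. \<forall>y\<in>\<Lambda>. f' x y = K x y))"

end

theory Submission
  imports Defs
begin

text \<open>
  The determinants of size one, two and three determine the diagonal, the products
  \<open>f x y * f y x\<close>, and the sum of the two cyclic products \<open>f x y * f y z * f z x\<close> and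
  \<open>f x z * f z y * f y x\<close> around a triangle. As the product of these two cyclic products is
  determined as well, they are fixed up to order: on every triangle, \<open>K\<close> has the cyclic
  products of \<open>Q\<close> or those of the transpose of \<open>Q\<close>, or both if the two products coincide.

  If the same alternative holds on all triangles, the theorem follows: when all cyclic products
  agree, \<open>K / Q\<close> is a multiplicative
  cocycle off the diagonal, hence of the form \<open>g x / g y\<close>; in the other
  case the same argument applies to the transpose of \<open>Q\<close>.

  The work is to exclude that one triangle has only the first alternative and another one only
  the second. On four points this follows from the determinants of size four: if,
  of the three faces through a vertex, one had only the second alternative and the others had the
  first but not both the second, then the equality of the sums of the 4-cycles would force a
  minor of \<open>Q\<close> to vanish (\<open>lone_reversed_face\<close>, \<open>tetrahedron\<close>).
  Larger sets reduce to four points because the cyclic products on three faces of a tetrahedron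
  determine the one on the fourth face (\<open>cycle3_tetrahedron\<close>): of two triangles of
  opposite kind, the first can be moved to a vertex of the second, and the remaining four points
  then carry two faces of opposite kind (\<open>uniform\<close>).
\<close>

section \<open>Small determinants\<close>

text \<open>
  In this form of the Laplace expansion the smaller determinants are again those of explicitly
  indexed matrices, so that it can be iterated by rewriting.
\<close>

lemma det_expand_first_row:
  "det (mat (Suc n) (Suc n) f) =
    (\<Sum>j<Suc n. f (0, j) * ((-1) ^ j * det (mat n n (\<lambda>(i, k). f (Suc i, if k < j then k else Suc k)))))"
proof -
  let ?A = "mat (Suc n) (Suc n) f"
  have "det ?A = (\<Sum>j<Suc n. ?A $$ (0, j) * cofactor ?A 0 j)"
    by (rule laplace_expansion_row[where n = "Suc n"]) auto
  also have "\<dots> = (\<Sum>j<Suc n. f (0, j) *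
      ((-1) ^ j * det (mat n n (\<lambda>(i, k). f (Suc i, if k < j then k else Suc k)))))"
  proof (intro sum.cong refl)
    fix j assume "j \<in> {..<Suc n}"
    moreover from this have "mat_delete ?A 0 j = mat n n (\<lambda>(i, k). f (Suc i, if k < j then k else Suc k))"
      by (intro eq_matI) (auto simp: mat_delete_def)
    ultimately show "?A $$ (0, j) * cofactor ?A 0 j = f (0, j) *
        ((-1) ^ j * det (mat n n (\<lambda>(i, k). f (Suc i, if k < j then k else Suc k))))"
      by (simp add: cofactor_def)
  qed
  finally show ?thesis .
qed

definition cycle3 :: "('a \<Rightarrow> 'a \<Rightarrow> 'f::field) \<Rightarrow> 'a \<Rightarrow> 'a \<Rightarrow> 'a \<Rightarrow> 'f" where
  "cycle3 f x y z = f x y * f y z * f z x"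

definition cycle4 :: "('a \<Rightarrow> 'a \<Rightarrow> 'f::field) \<Rightarrow> 'a \<Rightarrow> 'a \<Rightarrow> 'a \<Rightarrow> 'a \<Rightarrow> 'f" where
  "cycle4 f x y z w = f x y * f y z * f z w * f w x"

definition cycle4_sum :: "('a \<Rightarrow> 'a \<Rightarrow> 'f::field) \<Rightarrow> 'a \<Rightarrow> 'a \<Rightarrow> 'a \<Rightarrow> 'a \<Rightarrow> 'f" where
  "cycle4_sum f x y z w =
     cycle4 f x y z w + cycle4 f x w z y + cycle4 f x y w z
     + cycle4 f x z w y + cycle4 f x z y w + cycle4 f x w y z"

lemma det_mat_1: "det (mat 1 1 f) = f (0, 0)"
  using det_expand_first_row[of 0 f] by simp

lemma det_mat_2: "det (mat 2 2 f) = f (0, 0) * f (1, 1) - f (0, 1) * f (1, 0)"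
  using det_expand_first_row[of 1 f]
  by (simp add: det_mat_1[unfolded One_nat_def] numeral_2_eq_2 lessThan_Suc)

lemma det_mat_3:
  "det (mat 3 3 f) =
     f (0, 0) * (f (1, 1) * f (2, 2) - f (1, 2) * f (2, 1))
     - f (0, 1) * (f (1, 0) * f (2, 2) - f (1, 2) * f (2, 0))
     + f (0, 2) * (f (1, 0) * f (2, 1) - f (1, 1) * f (2, 0))"
  using det_expand_first_row[of 2 f]
  by (simp add: det_mat_2 numeral_3_eq_3 numeral_2_eq_2 lessThan_Suc)
    (simp add: det_mat_2[unfolded numeral_2_eq_2] algebra_simps)

text \<open>
  In the next two expansions the permutations are grouped by cycle type, up to inversion: all
  groups but the longest cycles are known from determinants of smaller size.
\<close>

lemma det_kernel_3:
  fixes f :: "'a \<Rightarrow> 'a \<Rightarrow> 'f::field"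
  assumes "x = (!) [a, b, c]"
  shows "det (mat 3 3 (\<lambda>(i, j). f (x i) (x j))) =
    cycle3 f a b c + cycle3 f a c b + f a a * f b b * f c c
    - f a a * (f b c * f c b) - f b b * (f a c * f c a) - f c c * (f a b * f b a)"
  unfolding det_mat_3 assms cycle3_def by (simp add: algebra_simps)

lemma det_kernel_4:
  fixes f :: "'a \<Rightarrow> 'a \<Rightarrow> 'f::field"
  assumes "x = (!) [a, b, c, d]"
  shows "det (mat 4 4 (\<lambda>(i, j). f (x i) (x j))) =
    - cycle4_sum f a b c d
    + f a a * (cycle3 f b c d + cycle3 f b d c) + f b b * (cycle3 f a c d + cycle3 f a d c)
    + f c c * (cycle3 f a b d + cycle3 f a d b) + f d d * (cycle3 f a b c + cycle3 f a c b)
    + (f a b * f b a) * (f c d * f d c) + (f a c * f c a) * (f b d * f d b)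
    + (f a d * f d a) * (f b c * f c b)
    - f a a * f b b * (f c d * f d c) - f a a * f c c * (f b d * f d b)
    - f a a * f d d * (f b c * f c b) - f b b * f c c * (f a d * f d a)
    - f b b * f d d * (f a c * f c a) - f c c * f d d * (f a b * f b a)
    + f a a * f b b * f c c * f d d"
proof -
  let ?f = "\<lambda>(i, j). f (x i) (x j)"
  have "det (mat 4 4 ?f) = (\<Sum>j<Suc 3. ?f (0, j) *
      ((-1) ^ j * det (mat 3 3 (\<lambda>(i, k). ?f (Suc i, if k < j then k else Suc k)))))"
    using det_expand_first_row[of 3 ?f] by simp
  then show ?thesis
    unfolding det_mat_3
    by (simp add: assms numeral_3_eq_3 lessThan_Suc numeral_2_eq_2)
       (simp add: cycle3_def cycle4_sum_def cycle4_def algebra_simps)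
qed

section \<open>Cyclic products on triangles and tetrahedra\<close>

text \<open>
  As the two products on a triangle have the same sum for \<open>K\<close> and \<open>Q\<close>, agreement for one
  orientation implies agreement for the other (\<open>agree_flip\<close>). The reversed alternative, in which \<open>K\<close> has the products of
  \<open>Q\<close> for the opposite orientation, is agreement with \<open>transposition Q\<close>.
\<close>

definition agree :: "('a \<Rightarrow> 'a \<Rightarrow> 'f::field) \<Rightarrow> ('a \<Rightarrow> 'a \<Rightarrow> 'f) \<Rightarrow> 'a \<Rightarrow> 'a \<Rightarrow> 'a \<Rightarrow> bool" where
  "agree K Q x y z \<longleftrightarrow> cycle3 K x y z = cycle3 Q x y z"

lemma agree_rotate: "agree K Q x y z \<longleftrightarrow> agree K Q y z x"
  unfolding agree_def cycle3_def by (simp add: mult_ac)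

lemma cycle3_transposition: "cycle3 (transposition f) x y z = cycle3 f x z y"
  unfolding cycle3_def transposition_def by (simp add: mult_ac)

lemma cycle3_tetrahedron:
  "cycle3 f p x y * cycle3 f p y z * cycle3 f p z x =
    cycle3 f x y z * ((f p x * f x p) * (f p y * f y p) * (f p z * f z p))"
  unfolding cycle3_def by (simp add: mult_ac)

lemma cycle4_via_triangles:
  "cycle4 f p x y z * (f p y * f y p) = cycle3 f p x y * cycle3 f p y z"
  unfolding cycle3_def cycle4_def by (simp add: mult_ac)

text \<open>
  Determinantal equivalence enters only through the cyclic products of length up to four. All
  conditions are invariant under transposition of \<open>Q\<close>, so that each result comes with a
  transposed version.
\<close>

locale equivalent_kernels =
  fixes \<Lambda> :: "'a set" and K Q :: "'a \<Rightarrow> 'a \<Rightarrow> 'f::field"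
  assumes nonzero: "\<lbrakk>x \<in> \<Lambda>; y \<in> \<Lambda>; x \<noteq> y\<rbrakk> \<Longrightarrow> K x y \<noteq> 0 \<and> Q x y \<noteq> 0"
    and diagonal: "x \<in> \<Lambda> \<Longrightarrow> K x x = Q x x"
    and cycles2: "\<lbrakk>x \<in> \<Lambda>; y \<in> \<Lambda>\<rbrakk> \<Longrightarrow> K x y * K y x = Q x y * Q y x"
    and cycles3: "\<lbrakk>x \<in> \<Lambda>; y \<in> \<Lambda>; z \<in> \<Lambda>\<rbrakk> \<Longrightarrow>
      cycle3 K x y z + cycle3 K x z y = cycle3 Q x y z + cycle3 Q x z y"
    and cycles4: "\<lbrakk>x \<in> \<Lambda>; y \<in> \<Lambda>; z \<in> \<Lambda>; w \<in> \<Lambda>\<rbrakk> \<Longrightarrow> cycle4_sum K x y z w = cycle4_sum Q x y z w"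
    and minor: "\<lbrakk>x \<in> \<Lambda>; y \<in> \<Lambda>; z \<in> \<Lambda>; w \<in> \<Lambda>; distinct [x, y, z, w]\<rbrakk> \<Longrightarrow>
      Q x y * Q z w \<noteq> Q x w * Q z y"
begin

lemma transposed: "equivalent_kernels \<Lambda> K (transposition Q)"
proof
  show "K x y \<noteq> 0 \<and> transposition Q x y \<noteq> 0" if "x \<in> \<Lambda>" "y \<in> \<Lambda>" "x \<noteq> y" for x y
    using nonzero[of x y] nonzero[of y x] that by (simp add: transposition_def)
  show "K x x = transposition Q x x" if "x \<in> \<Lambda>" for x
    using diagonal that by (simp add: transposition_def)
  show "K x y * K y x = transposition Q x y * transposition Q y x" if "x \<in> \<Lambda>" "y \<in> \<Lambda>" for x y
    using cycles2 that by (simp add: transposition_def mult.commute)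
  show "cycle3 K x y z + cycle3 K x z y
      = cycle3 (transposition Q) x y z + cycle3 (transposition Q) x z y"
    if "x \<in> \<Lambda>" "y \<in> \<Lambda>" "z \<in> \<Lambda>" for x y z
    using cycles3[of x y z] that by (simp add: cycle3_transposition add.commute)
  show "cycle4_sum K x y z w = cycle4_sum (transposition Q) x y z w"
    if "x \<in> \<Lambda>" "y \<in> \<Lambda>" "z \<in> \<Lambda>" "w \<in> \<Lambda>" for x y z w
    unfolding cycles4[OF that] by (simp add: cycle4_sum_def cycle4_def transposition_def mult_ac add_ac)
  show "transposition Q x y * transposition Q z w \<noteq> transposition Q x w * transposition Q z y"
    if "x \<in> \<Lambda>" "y \<in> \<Lambda>" "z \<in> \<Lambda>" "w \<in> \<Lambda>" "distinct [x, y, z, w]" for x y z w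
    using minor[of y x w z] that by (auto simp: transposition_def mult_ac)
qed

lemma agree_degenerate:
  assumes "x \<in> \<Lambda>" "y \<in> \<Lambda>" "z \<in> \<Lambda>" "\<not> distinct [x, y, z]"
  shows "agree K Q x y z"
  using assms diagonal cycles2 by (auto simp: agree_def cycle3_def mult_ac mult.left_commute)

lemma agree_flip:
  assumes "x \<in> \<Lambda>" "y \<in> \<Lambda>" "z \<in> \<Lambda>"
  shows "agree K Q x y z \<longleftrightarrow> agree K Q x z y"
  using cycles3[OF assms] by (metis add_right_cancel add_left_cancel agree_def)

text \<open>
  The two cyclic products on a triangle have the same sum and the same product for \<open>K\<close> and
  \<open>Q\<close>, so they are the roots of the same quadratic polynomial.
\<close>

lemma agree_or_reversed:
  assumes "x \<in> \<Lambda>" "y \<in> \<Lambda>" "z \<in> \<Lambda>"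
  shows "agree K Q x y z \<or> agree K (transposition Q) x y z"
proof -
  have cycle_prod: "cycle3 f x y z * cycle3 f x z y
      = (f x y * f y x) * (f y z * f z y) * (f x z * f z x)" for f :: "'a \<Rightarrow> 'a \<Rightarrow> 'f"
    by (simp add: cycle3_def mult_ac)
  have prod_eq: "cycle3 K x y z * cycle3 K x z y = cycle3 Q x y z * cycle3 Q x z y"
    unfolding cycle_prod using assms cycles2 by simp
  have "(cycle3 K x y z - cycle3 Q x y z) * (cycle3 K x y z - cycle3 Q x z y)
     = cycle3 K x y z * (cycle3 K x y z + cycle3 K x z y - (cycle3 Q x y z + cycle3 Q x z y))
       - (cycle3 K x y z * cycle3 K x z y - cycle3 Q x y z * cycle3 Q x z y)"
    by (simp add: algebra_simps)
  also have "\<dots> = 0"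
    using cycles3[OF assms] prod_eq by simp
  finally show ?thesis
    by (simp add: agree_def cycle3_transposition)
qed

lemma agree_fourth_face:
  assumes "p \<in> \<Lambda>" "x \<in> \<Lambda>" "y \<in> \<Lambda>" "z \<in> \<Lambda>"
    and "agree K Q p x y" "agree K Q p y z" "agree K Q p z x"
  shows "agree K Q x y z"
proof (cases "p \<in> {x, y, z}")
  case True
  then show ?thesis
    using assms agree_rotate agree_flip by (metis empty_iff insert_iff)
next
  case False
  then have "(Q p x * Q x p) * (Q p y * Q y p) * (Q p z * Q z p) \<noteq> 0"
    using assms(1-4) nonzero by auto
  then show ?thesis
    using assms cycle3_tetrahedron[of K p x y z] cycle3_tetrahedron[of Q p x y z] cycles2
    by (simp add: agree_def)
qed

text \<open>
  Write \<open>t x y\<close> for the product of \<open>Q\<close> around the triangle \<open>p, x, y\<close>. The face \<open>x, y, z\<close>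
  must be reversed, because its agreement would pass to \<open>p, x, y\<close>; this gives \<open>t y z * t z x = t z y * t x z\<close>; the equality of the sums of the 4-cycles
  factors into a second such relation. If \<open>t y z\<close> and \<open>t z y\<close> were different, the two
  relations together would determine the ratio of \<open>t x z\<close> and \<open>t y z\<close>, which is
  exactly the vanishing of the minor with rows \<open>x, y\<close> and columns \<open>z, p\<close>.
\<close>

lemma lone_reversed_face:
  assumes mem: "p \<in> \<Lambda>" "x \<in> \<Lambda>" "y \<in> \<Lambda>" "z \<in> \<Lambda>" and dist: "distinct [p, x, y, z]"
    and not_agree: "\<not> agree K Q p x y" and agrees: "agree K Q p y z" "agree K Q p z x"
  shows "agree K (transposition Q) p y z \<and> agree K (transposition Q) p z x"
proof -
  define t where "t = cycle3 Q p"
  define a where "a u = Q p u * Q u p" for u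
  have Qnz: "Q u v \<noteq> 0" if "u \<in> {p, x, y, z}" "v \<in> {p, x, y, z}" "u \<noteq> v" for u v
    using that mem nonzero by auto
  have anz: "a x \<noteq> 0" "a y \<noteq> 0" "a z \<noteq> 0"
    using Qnz dist unfolding a_def by auto
  have tnz: "t y z \<noteq> 0" "t x y \<noteq> 0" "t y x \<noteq> 0"
    using Qnz dist unfolding t_def cycle3_def by auto
  have K_xy: "cycle3 K p x y = t y x" "cycle3 K p y x = t x y"
    using agree_or_reversed[of p x y] cycles3[of p x y] not_agree mem
    by (auto simp: agree_def cycle3_transposition t_def add.commute)
  have K_yz: "cycle3 K p y z = t y z" "cycle3 K p z y = t z y"
    and K_zx: "cycle3 K p z x = t z x" "cycle3 K p x z = t x z"
    using agrees agree_flip mem by (auto simp: agree_def t_def)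
  have K_a: "K p u * K u p = a u" if "u \<in> \<Lambda>" for u
    using cycles2[of p u] mem that by (simp add: a_def)
  have t_xy: "t x y \<noteq> t y x"
    using not_agree K_xy by (simp add: agree_def t_def)

  have "\<not> agree K Q x y z"
  proof
    assume "agree K Q x y z"
    then have "t y x * t y z * t z x = t x y * t y z * t z x"
      using cycle3_tetrahedron[of K p x y z] cycle3_tetrahedron[of Q p x y z] mem
      by (simp add: agree_def K_xy K_yz K_zx K_a t_def[symmetric] a_def[symmetric])
    moreover have "t z x \<noteq> 0"
      using Qnz dist unfolding t_def cycle3_def by auto
    ultimately show False
      using t_xy tnz by simp
  qed
  then have "cycle3 K x y z = cycle3 Q x z y"
    using agree_or_reversed[of x y z] mem by (simp add: agree_def cycle3_transposition)
  then have "t y x * t y z * t z x = t x z * t z y * t y x"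
    using cycle3_tetrahedron[of K p x y z] cycle3_tetrahedron[of Q p x z y] mem
    by (simp add: K_xy K_yz K_zx K_a t_def[symmetric] a_def[symmetric] mult_ac)
  then have reversed: "t y z * t z x = t x z * t z y"
    using tnz by (simp add: mult_ac)

  have expand: "cycle4_sum f p x y z * (b x * b y * b z) =
      b x * b z * (s x y * s y z + s z y * s y x) + b x * b y * (s x z * s z y + s y z * s z x)
      + b y * b z * (s y x * s x z + s z x * s x y)"
    if "s = cycle3 f p" "b = (\<lambda>u. f p u * f u p)" for f :: "'a \<Rightarrow> 'a \<Rightarrow> 'f" and s b
    unfolding cycle4_sum_def that cycle4_via_triangles[symmetric] by (simp add: algebra_simps)
  have "a x * a z * (t y x * t y z + t z y * t x y) + a x * a y * (t x z * t z y + t y z * t z x)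
      + a y * a z * (t x y * t x z + t z x * t y x)
    = a x * a z * (t x y * t y z + t z y * t y x) + a x * a y * (t x z * t z y + t y z * t z x)
      + a y * a z * (t y x * t x z + t z x * t x y)"
    using expand[OF refl refl, of K] expand[OF refl refl, of Q] cycles4[of p x y z] mem
    by (simp add: K_xy K_yz K_zx K_a t_def[symmetric] a_def[symmetric])
  then have "a z * (t x y - t y x) * (a x * (t y z - t z y) - a y * (t x z - t z x)) = 0"
    by (simp add: algebra_simps)
  then have ratio: "a x * (t y z - t z y) = a y * (t x z - t z x)"
    using anz t_xy by simp

  have eq_yz: "t y z = t z y"
  proof (rule ccontr)
    assume neq: "t y z \<noteq> t z y"
    have "a x * t y z * (t y z - t z y) = t y z * (a x * (t y z - t z y))"
      by (simp add: mult_ac)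
    also have "\<dots> = a y * (t x z * t y z - t y z * t z x)"
      unfolding ratio by (simp add: algebra_simps)
    also have "\<dots> = a y * t x z * (t y z - t z y)"
      unfolding reversed by (simp add: algebra_simps)
    finally have "a x * t y z = a y * t x z"
      using neq by simp
    then have "(Q p x * Q p y * Q z p) * (Q x p * Q y z) = (Q p x * Q p y * Q z p) * (Q x z * Q y p)"
      by (simp add: a_def t_def cycle3_def mult_ac)
    moreover have "Q p x * Q p y * Q z p \<noteq> 0"
      using Qnz dist by auto
    ultimately have "Q x p * Q y z = Q x z * Q y p"
      by (metis mult_left_cancel)
    then show False
      using minor[of x z y p] mem dist by auto
  qed
  then have "t z x = t x z"
    using reversed tnz by (simp add: mult_ac)
  with eq_yz show ?thesis
    by (simp add: agree_def cycle3_transposition K_yz K_zx t_def[symmetric])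
qed

interpretation transposed: equivalent_kernels \<Lambda> K "transposition Q"
  by (rule transposed)

lemma transposition_transposition: "transposition (transposition f) = f"
  by (simp add: transposition_def)

text \<open>
  Among the three faces through \<open>p\<close>, one alternative holds at least twice, so a failure of both
  conclusions leaves a lone face of the other kind, for \<open>Q\<close> or for its transpose.
\<close>

lemma faces_at_vertex:
  assumes mem: "p \<in> \<Lambda>" "x \<in> \<Lambda>" "y \<in> \<Lambda>" "z \<in> \<Lambda>" and dist: "distinct [p, x, y, z]"
  shows "agree K Q p x y \<and> agree K Q p y z \<and> agree K Q p z x \<or>
    agree K (transposition Q) p x y \<and> agree K (transposition Q) p y z \<and> agree K (transposition Q) p z x"
proof -
  have dist': "distinct [p, y, z, x]" "distinct [p, z, x, y]"
    using dist by auto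
  note lone = lone_reversed_face[OF mem dist]
    lone_reversed_face[OF mem(1,3,4,2) dist'(1)] lone_reversed_face[OF mem(1,4,2,3) dist'(2)]
  note lone_transposed = transposed.lone_reversed_face[OF mem dist, unfolded transposition_transposition]
    transposed.lone_reversed_face[OF mem(1,3,4,2) dist'(1), unfolded transposition_transposition]
    transposed.lone_reversed_face[OF mem(1,4,2,3) dist'(2), unfolded transposition_transposition]
  show ?thesis
    using lone lone_transposed agree_or_reversed mem by blast
qed

lemma tetrahedron:
  assumes mem: "p \<in> \<Lambda>" "x \<in> \<Lambda>" "y \<in> \<Lambda>" "z \<in> \<Lambda>"
  shows "agree K Q p x y \<and> agree K Q p y z \<and> agree K Q p z x \<and> agree K Q x y z \<or>
    agree K (transposition Q) p x y \<and> agree K (transposition Q) p y z \<and>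
    agree K (transposition Q) p z x \<and> agree K (transposition Q) x y z"
proof -
  have faces: "agree K Q p x y \<and> agree K Q p y z \<and> agree K Q p z x \<or>
    agree K (transposition Q) p x y \<and> agree K (transposition Q) p y z \<and> agree K (transposition Q) p z x"
  proof (cases "distinct [p, x, y, z]")
    case True
    with mem show ?thesis by (rule faces_at_vertex)
  next
    \<comment> \<open>With a repeated point, at most one triangle is not degenerate, up to orientation.\<close>
    case False
    note flips = agree_flip transposed.agree_flip
    note degenerate = agree_degenerate transposed.agree_degenerate
    consider "p = x" | "p = y" | "p = z" | "x = y" | "y = z" | "x = z"
      using False by auto
    then show ?thesis
      by cases (use mem degenerate flips agree_or_reversed in auto)
  qed
  then show ?thesis
    using agree_fourth_face transposed.agree_fourth_face mem by blast
qed

text \<open>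
  Suppose that a triangle \<open>a, b, c\<close> is only reversed and \<open>p, u, v\<close> only agrees. By the relation
  between the faces of a tetrahedron, \<open>p\<close> and two of the points \<open>a, b, c\<close> form a triangle
  \<open>p, x, y\<close> that is only reversed. All
  tetrahedra containing \<open>p, x, y\<close> are then reversed and all containing \<open>p, u, v\<close> agree, so the
  triangles \<open>p, x, u\<close>, \<open>p, x, v\<close>, \<open>p, y, u\<close> and \<open>p, y, v\<close> do both. Hence \<open>x, y, u\<close> is as little in
  agreement as \<open>p, x, y\<close>, and \<open>u, v, x\<close> as little reversed as \<open>p, u, v\<close>. They are faces of the
  same tetrahedron.
\<close>

lemma uniform:
  "(\<forall>x\<in>\<Lambda>. \<forall>y\<in>\<Lambda>. \<forall>z\<in>\<Lambda>. agree K Q x y z) \<or> (\<forall>x\<in>\<Lambda>. \<forall>y\<in>\<Lambda>. \<forall>z\<in>\<Lambda>. agree K (transposition Q) x y z)"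
proof (rule ccontr)
  let ?T = "transposition Q"
  assume "\<not> ?thesis"
  then obtain a b c p u v where mem: "a \<in> \<Lambda>" "b \<in> \<Lambda>" "c \<in> \<Lambda>" "p \<in> \<Lambda>" "u \<in> \<Lambda>" "v \<in> \<Lambda>"
    and abc: "\<not> agree K Q a b c" and puv: "\<not> agree K ?T p u v"
    by blast
  obtain x y where xy: "x \<in> \<Lambda>" "y \<in> \<Lambda>" "\<not> agree K Q p x y"
    using agree_fourth_face[of p a b c] abc mem by blast
  have reversed: "agree K ?T p y w" "agree K ?T p w x" "agree K ?T x y w" if "w \<in> \<Lambda>" for w
    using tetrahedron[of p x y w] xy mem that by auto
  have agrees: "agree K Q p v w" "agree K Q p w u" "agree K Q u v w" if "w \<in> \<Lambda>" for w
    using tetrahedron[of p u v w] puv mem that by auto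
  have "\<not> agree K Q x y u"
  proof
    assume "agree K Q x y u"
    then have "agree K Q u x y" "agree K Q u y p" "agree K Q u p x"
      using agrees(2) agree_rotate agree_flip mem xy by metis+
    then have "agree K Q x y p"
      using agree_fourth_face[of u x y p] mem xy by blast
    then show False
      using xy agree_rotate by metis
  qed
  moreover have "\<not> agree K ?T u v x"
  proof
    assume "agree K ?T u v x"
    then have "agree K ?T x u v" "agree K ?T x v p" "agree K ?T x p u"
      using reversed(2) agree_rotate transposed.agree_flip mem xy by metis+
    then have "agree K ?T u v p"
      using transposed.agree_fourth_face[of x u v p] mem xy by blast
    then show False
      using puv agree_rotate by metis
  qed
  ultimately show False
    using tetrahedron[of x y u v] mem xy agree_rotate by metis
qed

section \<open>From cyclic products to transformations\<close>

text \<open>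
  If all triangles agree, \<open>K / Q\<close> is a multiplicative cocycle, and its values against a fixed
  base point provide the conjugating function.
\<close>

lemma agree_imp_conjugation:
  assumes "\<forall>x\<in>\<Lambda>. \<forall>y\<in>\<Lambda>. \<forall>z\<in>\<Lambda>. agree K Q x y z"
  shows "\<exists>g. (\<forall>x\<in>\<Lambda>. g x \<noteq> 0) \<and> (\<forall>x\<in>\<Lambda>. \<forall>y\<in>\<Lambda>. conjugation g Q x y = K x y)"
proof (cases "\<Lambda> = {}")
  case False
  then obtain p where p: "p \<in> \<Lambda>" by blast
  \<comment> \<open>The diagonal values at \<open>p\<close> may vanish, so the value at \<open>p\<close> is set separately.\<close>
  define g where "g x = (if x = p then 1 else K x p / Q x p)" for x
  have gnz: "g x \<noteq> 0" if "x \<in> \<Lambda>" for x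
    using that p nonzero[of x p] by (simp add: g_def)
  have "conjugation g Q x y = K x y" if x: "x \<in> \<Lambda>" and y: "y \<in> \<Lambda>" for x y
  proof -
    consider "x = y" | "x \<noteq> y" "y = p" | "x \<noteq> y" "x = p" | "x \<noteq> y" "x \<noteq> p" "y \<noteq> p"
      by blast
    then show ?thesis
    proof cases
      case 1
      then show ?thesis
        using diagonal[OF x] gnz[OF x] by (simp add: conjugation_def)
    next
      case 2
      then show ?thesis
        using nonzero[OF x p] by (simp add: conjugation_def g_def)
    next
      case 3
      then show ?thesis
        using nonzero[OF y p] cycles2[OF p y] by (simp add: conjugation_def g_def field_simps)
    next
      case 4
      have "Q p x * (K x y * K y p * Q x p) = K x y * K y p * (K p x * K x p)"
        unfolding cycles2[OF p x] by (simp add: mult_ac)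
      also have "\<dots> = cycle3 K x y p * K x p"
        by (simp add: cycle3_def mult_ac)
      also have "\<dots> = cycle3 Q x y p * K x p"
        using assms x y p by (simp add: agree_def)
      also have "\<dots> = Q p x * (Q x y * Q y p * K x p)"
        by (simp add: cycle3_def mult_ac)
      finally have "K x y * K y p * Q x p = Q x y * Q y p * K x p"
        using nonzero[OF p x] 4 by simp
      then show ?thesis
        using nonzero[OF x p] nonzero[OF y p] 4 by (simp add: conjugation_def g_def field_simps)
    qed
  qed
  with gnz show ?thesis by blast
qed simp

lemma transformable: "transformable_into \<Lambda> Q K"
  using uniform
proof
  assume "\<forall>x\<in>\<Lambda>. \<forall>y\<in>\<Lambda>. \<forall>z\<in>\<Lambda>. agree K Q x y z"
  from agree_imp_conjugation[OF this] show ?thesis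
    unfolding transformable_into_def transformation_step_def by blast
next
  assume "\<forall>x\<in>\<Lambda>. \<forall>y\<in>\<Lambda>. \<forall>z\<in>\<Lambda>. agree K (transposition Q) x y z"
  from equivalent_kernels.agree_imp_conjugation[OF transposed this]
  obtain g where g: "\<forall>x\<in>\<Lambda>. g x \<noteq> 0"
    and eq: "\<forall>x\<in>\<Lambda>. \<forall>y\<in>\<Lambda>. conjugation g (transposition Q) x y = K x y"
    by blast
  have "transformation_step \<Lambda> Q (transposition Q)"
    "transformation_step \<Lambda> (transposition Q) (conjugation g (transposition Q))"
    using g unfolding transformation_step_def by blast+
  then have "(transformation_step \<Lambda>)\<^sup>*\<^sup>* Q (conjugation g (transposition Q))"
    by auto
  with eq show ?thesis
    unfolding transformable_into_def by blast
qed

end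

theorem theorem1p1:
  fixes \<Lambda> :: "'a set" and K Q :: "'a \<Rightarrow> 'a \<Rightarrow> 'f::field"
  assumes "\<And>x y. \<lbrakk>x \<in> \<Lambda>; y \<in> \<Lambda>; x \<noteq> y\<rbrakk> \<Longrightarrow> K x y \<noteq> 0 \<and> Q x y \<noteq> 0"
    and "\<And>x y z w. \<lbrakk>x \<in> \<Lambda>; y \<in> \<Lambda>; z \<in> \<Lambda>; w \<in> \<Lambda>; distinct [x, y, z, w]\<rbrakk> \<Longrightarrow>
           det (mat_of_rows_list 2 [[Q x y, Q x w], [Q z y, Q z w]]) \<noteq> 0"
    and "determinantally_equivalent \<Lambda> K Q"
  shows "transformable_into \<Lambda> Q K"
proof -
  have dets: "det (mat (length xs) (length xs) (\<lambda>(i, j). Q (xs ! i) (xs ! j)))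
      = det (mat (length xs) (length xs) (\<lambda>(i, j). K (xs ! i) (xs ! j)))"
    if "xs \<noteq> []" "set xs \<subseteq> \<Lambda>" for xs
    using assms(3)[unfolded determinantally_equivalent_def, rule_format, of "length xs" "(!) xs"]
      that nth_mem by (fastforce simp: Suc_le_eq)
  have diag: "K x x = Q x x" if "x \<in> \<Lambda>" for x
    using dets[of "[x]"] that by (simp add: det_mat_1[unfolded One_nat_def])
  have cyc2: "K x y * K y x = Q x y * Q y x" if "x \<in> \<Lambda>" "y \<in> \<Lambda>" for x y
    using dets[of "[x, y]"] that diag by (simp add: det_mat_2[unfolded numeral_2_eq_2])
  have cyc3: "cycle3 K x y z + cycle3 K x z y = cycle3 Q x y z + cycle3 Q x z y"
    if "x \<in> \<Lambda>" "y \<in> \<Lambda>" "z \<in> \<Lambda>" for x y z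
    using dets[of "[x, y, z]"] det_kernel_3[OF refl, of Q x y z] det_kernel_3[OF refl, of K x y z]
      that diag cyc2 by (simp add: numeral_3_eq_3)
  have cyc4: "cycle4_sum K x y z w = cycle4_sum Q x y z w"
    if "x \<in> \<Lambda>" "y \<in> \<Lambda>" "z \<in> \<Lambda>" "w \<in> \<Lambda>" for x y z w
    using dets[of "[x, y, z, w]"] det_kernel_4[OF refl, of Q x y z w]
      det_kernel_4[OF refl, of K x y z w] that diag cyc2 cyc3
    by (simp add: eval_nat_numeral)
  have minor: "Q x y * Q z w \<noteq> Q x w * Q z y"
    if "x \<in> \<Lambda>" "y \<in> \<Lambda>" "z \<in> \<Lambda>" "w \<in> \<Lambda>" "distinct [x, y, z, w]" for x y z w
    using assms(2)[OF that] by (simp add: mat_of_rows_list_def det_mat_2 flip: numeral_2_eq_2)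
  interpret equivalent_kernels \<Lambda> K Q
    by unfold_locales (fact assms(1) diag cyc2 cyc3 cyc4 minor)+
  show ?thesis by (rule transformable)
qed

end
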